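(* Fix a constant $\overline{\rho}<1/2$. Let $A\in\mathbb{Q}^{n\times n}$ be nonsingular with $\rho(|A^{-1}|)\le\overline{\rho}$, let $b\in\mathbb{Q}^n$, write $A=\bar A/d_A$, $b=\bar b/d_b$ with $\bar A\in\mathbb{Z}^{n\times n}$, $\bar b\in\mathbb{Z}^n$, $d_A,d_b\in\mathbb{Z}_{>0}$, let $L=\max\{d_b,d_A,\|\bar b\|_\infty,\|\bar A\|_{\max}\}$, and let $m\in\{1,\dots,n\}$. Then the sign-flip algorithm applied directly to the absolute value equation $Ax-|x|=b$ (without preconditioning) with the randomized $m$-flip rule terminates at the unique solution of $Ax-|x|=b$, and its expected iteration complexity is $\mathcal{O}\bigl(n^3\log(nL)/m\bigr)$.
   Context: $|X|$ and $|x|$ are entrywise; $\rho(\cdot)$ is the spectral radius; $\|\cdot\|_\infty$ for vectors is the maximum absolute entry; $\|X\|_{\max}=\max_{i,j}|X_{ij}|$. For $z\in\{-1,1\}^n$ write $Z=\operatorname{Diag}(z)$; $A-Z$ is nonsingular for all such $z$ under the stated condition. Sign-flip algorithm: initialize $z\in\{-1,1\}^n$; compute $x=(A-Z)^{-1}b$ and the mismatch set $\mathcal{V}_z=\{i\in\{1,\dots,n\}: z_ix_i<0\}$. While $\mathcal{V}_z\neq\emptyset$: select a nonempty subset $S\subseteq\mathcal{V}_z$ by some rule; replace $z_i$ by $-z_i$ for $i\in S$; recompute $Z$, $x=(A-Z)^{-1}b$ and $\mathcal{V}_z$. When $\mathcal{V}_z=\emptyset$, return $x$. One pass through the while loop is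 one iteration. Randomized $m$-flip rule: at each iteration $S$ is chosen uniformly at random (given the current $z$, independently of the past) among the subsets of $\mathcal{V}_z$ of cardinality $\min\{m,\operatorname{card}(\mathcal{V}_z)\}$. The constant implied by $\mathcal{O}$ depends only on the fixed constant $\overline{\rho}$. *)

theory Defs
  imports
    "HOL-Probability.SPMF"
    "Jordan_Normal_Form.Spectral_Radius"
    "Jordan_Normal_Form.Gauss_Jordan_Elimination"
begin

text \<open>
  Vectors and matrices are those of the \<open>Jordan_Normal_Form\<close> library, whose dimension is a term.
  Indices run over \<open>{0..<n}\<close>.  Real entries are used throughout, rationality being a separate
  hypothesis, so that uniqueness of solutions refers to all of $\mathbb{R}^n$.
\<close>

text \<open>Only meaningful for invertible \<open>A\<close>; \<^const>\<open>mat_inverse\<close> yields \<^const>\<open>None\<close> otherwise.\<close>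

definition inv_mat :: "real mat \<Rightarrow> real mat" where
  "inv_mat A = the (mat_inverse A)"

definition abs_mat :: "real mat \<Rightarrow> real mat" where
  "abs_mat X = map_mat abs X"

definition abs_vec :: "real vec \<Rightarrow> real vec" where
  "abs_vec x = map_vec abs x"

definition real_spectral_radius :: "real mat \<Rightarrow> real" where
  "real_spectral_radius X = spectral_radius (map_mat complex_of_real X)"

definition ave_solution :: "real mat \<Rightarrow> real vec \<Rightarrow> real vec \<Rightarrow> bool" where
  "ave_solution A b x \<longleftrightarrow> x \<in> carrier_vec (dim_col A) \<and> A *\<^sub>v x - abs_vec x = b"

definition sign_vecs :: "nat \<Rightarrow> real vec set" where
  "sign_vecs n = {z \<in> carrier_vec n. \<forall>i<n. z $ i \<in> {-1, 1}}"

definition Diag :: "real vec \<Rightarrow> real mat" where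
  "Diag z = mat_diag (dim_vec z) (\<lambda>i. z $ i)"

definition iterate :: "real mat \<Rightarrow> real vec \<Rightarrow> real vec \<Rightarrow> real vec" where
  "iterate A b z = inv_mat (A - Diag z) *\<^sub>v b"

definition mismatch :: "real mat \<Rightarrow> real vec \<Rightarrow> real vec \<Rightarrow> nat set" where
  "mismatch A b z = {i. i < dim_vec z \<and> z $ i * iterate A b z $ i < 0}"

definition flip :: "nat set \<Rightarrow> real vec \<Rightarrow> real vec" where
  "flip S z = vec (dim_vec z) (\<lambda>i. if i \<in> S then - z $ i else z $ i)"

text \<open>
  A randomized selection rule sends the mismatch set to the distribution of the selected subset.
  The result pairs the returned vector with the number of executed iterations; runs that do not
  terminate account for the mass missing from the subprobability distribution.
\<close>

partial_function (spmf) sign_flip ::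
  "(nat set \<Rightarrow> nat set pmf) \<Rightarrow> real mat \<Rightarrow> real vec \<Rightarrow> real vec \<Rightarrow> (real vec \<times> nat) spmf"
where
  "sign_flip rule A b z =
     (if mismatch A b z = {} then return_spmf (iterate A b z, 0)
      else bind_spmf (spmf_of_pmf (rule (mismatch A b z)))
             (\<lambda>S. map_spmf (\<lambda>(x, k). (x, Suc k)) (sign_flip rule A b (flip S z))))"

text \<open>One iteration, for some realization of the random selection.\<close>

definition sign_flip_step ::
  "(nat set \<Rightarrow> nat set pmf) \<Rightarrow> real mat \<Rightarrow> real vec \<Rightarrow> real vec \<Rightarrow> real vec \<Rightarrow> bool"
where
  "sign_flip_step rule A b z z' \<longleftrightarrow>
     mismatch A b z \<noteq> {} \<and> (\<exists>S \<in> set_pmf (rule (mismatch A b z)). z' = flip S z)"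

definition random_flip_rule :: "nat \<Rightarrow> nat set \<Rightarrow> nat set pmf" where
  "random_flip_rule m V = pmf_of_set {S. S \<subseteq> V \<and> card S = min m (card V)}"

text \<open>This is the expected number of iterations provided the run is lossless.\<close>

definition expected_iterations :: "(real vec \<times> nat) spmf \<Rightarrow> ennreal" where
  "expected_iterations p = (\<integral>\<^sup>+ r. of_nat (snd r) \<partial>measure_spmf p)"

definition max_norm_vec :: "int vec \<Rightarrow> int" where
  "max_norm_vec v = Max (abs ` vec_set v)"

definition max_norm_mat :: "int mat \<Rightarrow> int" where
  "max_norm_mat X = Max (abs ` elements_mat X)"

end

theory Submission
  imports Defs
begin

text \<open>
  Write $x^z$ for the iterate at $z$, and choose weights $v > 0$ with $|A^{-1}| v \le \theta v$,
  $\theta < 1/2$.  The key fact is a sign dominance property.  Prescribe signs on a set $F$ of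
  indices and let $c$ be the iterate for the vector that has these signs on $F$ and zeros elsewhere.
  A contraction estimate in the $v$-weighted maximum norm gives $|x^z_i - c_i| < |c_j|$ (weighted)
  for every sign vector $z$ with the prescribed signs, where $j \notin F$ maximizes the weighted
  $|c_j|$.  Hence the sign of $x^z_j$ depends on the signs on $F$ only.

  If the indices flipped finitely often in an infinite run form $F$, then the dominant
  $j \notin F$ is eventually flipped at most once, a contradiction.  So every realization
  terminates.  For the expectation, call $F$ settled at $z$ if no sign vector agreeing with $z$ on
  $F$ has a mismatch in $F$.  Settled sets stay settled; if there is a mismatch and $F$ is a settled set of
  maximal size, then the dominant $j \notin F$ is a mismatch, is selected with probability at least
  $m/n$, and once flipped enlarges the settled set.  Therefore $(n/m)(n - \max |F|)$ bounds the
  expected number of iterations.  This is at most $n^2/m$, and $nL \ge 2$ absorbs it into the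
  stated bound.
\<close>

unbundle no vec_syntax

section \<open>Positive weights extracted from the spectral radius bound\<close>

text \<open>The weights are a truncated Neumann series $\sum_{k \le N} (B/\theta)^k \mathbf 1$.\<close>

lemma weighted_row_bound:
  fixes B :: "real mat"
  assumes B: "B \<in> carrier_mat n n" and n: "n > 0"
    and nonneg: "\<And>i j. i < n \<Longrightarrow> j < n \<Longrightarrow> 0 \<le> B $$ (i, j)"
    and radius: "real_spectral_radius B < \<theta>"
  obtains v :: "nat \<Rightarrow> real" where
    "\<And>i. i < n \<Longrightarrow> 0 < v i"
    "\<And>i. i < n \<Longrightarrow> (\<Sum>j<n. B $$ (i, j) * v j) \<le> \<theta> * v i"
proof -
  let ?c = "map_mat complex_of_real"
  have cB: "?c B \<in> carrier_mat n n" using B by simp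
  have sr0: "0 \<le> real_spectral_radius B"
    using spectral_radius_mem_max(1)[OF cB n] unfolding real_spectral_radius_def by auto
  \<comment> \<open>Strictly between the spectral radius and \<theta>: the powers of D = B/r stay
    bounded, and the remaining ratio r/\<theta> < 1 supplies geometric decay.\<close>
  define r where "r = (real_spectral_radius B + \<theta>) / 2"
  have r: "0 < r" "r < \<theta>" "real_spectral_radius B < r"
    using sr0 radius by (auto simp: r_def)
  define D where "D = (1 / r) \<cdot>\<^sub>m B"
  have D: "D \<in> carrier_mat n n" using B by (simp add: D_def)
  have cD: "?c D \<in> carrier_mat n n" using D by simp
  have "spectral_radius (?c D) < 1"
  proof -
    \<comment> \<open>Scaling back, r \<mu> is an eigenvalue of B, so r |\<mu>| is at most the
      spectral radius of B, which lies below r.\<close>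
    obtain \<mu> where \<mu>: "eigenvalue (?c D) \<mu>" "spectral_radius (?c D) = norm \<mu>"
      using spectral_radius_mem_max(1)[OF cD n] unfolding spectrum_def by auto
    then obtain x where x: "eigenvector (?c D) x \<mu>" unfolding eigenvalue_def by auto
    have BD: "?c B = complex_of_real r \<cdot>\<^sub>m ?c D"
      using B r by (intro eq_matI) (auto simp: D_def)
    have xc: "x \<in> carrier_vec n" "x \<noteq> 0\<^sub>v n" "?c D *\<^sub>v x = \<mu> \<cdot>\<^sub>v x"
      using x cD unfolding eigenvector_def by auto
    have "?c B *\<^sub>v x = complex_of_real r \<cdot>\<^sub>v (?c D *\<^sub>v x)"
      unfolding BD using cD xc(1)
      by (intro eq_vecI) (auto simp: scalar_prod_def sum_distrib_left ac_simps)
    then have "eigenvector (?c B) x (complex_of_real r * \<mu>)"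
      unfolding eigenvector_def using xc cB by (auto simp: smult_smult_assoc)
    then have "norm (complex_of_real r * \<mu>) \<in> norm ` spectrum (?c B)"
      unfolding spectrum_def eigenvalue_def by auto
    then have "norm (complex_of_real r * \<mu>) \<le> real_spectral_radius B"
      using spectral_radius_mem_max(2)[OF cB n] unfolding real_spectral_radius_def by blast
    then have "r * norm \<mu> \<le> real_spectral_radius B" using r by (simp add: norm_mult)
    then have "r * norm \<mu> < r * 1" using r by linarith
    then show ?thesis using \<mu>(2) r by (simp only: mult_less_cancel_left_pos)
  qed
  from spectral_radius_jnf_norm_bound_less_1_upper_triangular[OF cD this]
  obtain c where c: "\<And>k. norm_bound (?c D ^\<^sub>m k) c" by auto
  have pow_c: "?c (D ^\<^sub>m k) = ?c D ^\<^sub>m k" for k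
    using of_real_hom.mat_hom_pow[OF D] by auto
  have Dk: "D ^\<^sub>m k \<in> carrier_mat n n" for k using D by simp
  have entry: "\<bar>(D ^\<^sub>m k) $$ (i, j)\<bar> \<le> c" if "i < n" "j < n" for i j k
  proof -
    have "norm (?c (D ^\<^sub>m k) $$ (i, j)) \<le> c"
      using c[of k] that cD unfolding norm_bound_def pow_c by auto
    then show ?thesis using that D by simp
  qed
  have Dnn: "0 \<le> D $$ (i, j)" if "i < n" "j < n" for i j
    using that nonneg r B by (auto simp: D_def)
  have BD: "B $$ (i, j) = r * D $$ (i, j)" if "i < n" "j < n" for i j
    using that r B by (auto simp: D_def)
  \<comment> \<open>The recursive form gives \<open>u_Suc\<close>; \<open>u_eq\<close> ties it to
    the powers of D, whose entries are uniformly bounded.\<close>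
  define u where "u k = (((\<lambda>w. D *\<^sub>v w) ^^ k) (vec n (\<lambda>_. 1)))" for k
  have u_eq: "u k = D ^\<^sub>m k *\<^sub>v vec n (\<lambda>_. 1)" for k
  proof (induction k)
    case 0
    then show ?case using D by (simp add: u_def)
  next
    case (Suc k)
    have comm: "D * D ^\<^sub>m k = D ^\<^sub>m k * D" for k
    proof (induction k)
      case 0 then show ?case using D by simp
    next
      case (Suc k)
      have "D * (D ^\<^sub>m k * D) = D * D ^\<^sub>m k * D"
        using D Dk by (intro assoc_mult_mat[symmetric]) auto
      then show ?case using Suc by simp
    qed
    have "u (Suc k) = D *\<^sub>v u k" by (simp add: u_def)
    also have "\<dots> = D * D ^\<^sub>m k *\<^sub>v vec n (\<lambda>_. 1)"
      unfolding Suc using D Dk by (intro assoc_mult_mat_vec[symmetric]) auto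
    finally show ?case by (simp add: comm)
  qed
  have u_carrier: "u k \<in> carrier_vec n" for k
    unfolding u_eq by (rule mult_mat_vec_carrier[OF Dk]) simp
  have u_Suc: "u (Suc k) $ i = (\<Sum>j<n. D $$ (i, j) * u k $ j)" if "i < n" for k i
  proof -
    have "u (Suc k) = D *\<^sub>v u k" by (simp add: u_def)
    then show ?thesis using that D u_carrier[of k]
      by (auto simp: scalar_prod_def lessThan_atLeast0)
  qed
  have u0: "u 0 $ i = 1" if "i < n" for i using that by (simp add: u_def)
  have unn: "0 \<le> u k $ i" if "i < n" for k i using that
  proof (induction k arbitrary: i)
    case 0 then show ?case by (simp add: u0)
  next
    case (Suc k) then show ?case by (auto simp: u_Suc intro!: sum_nonneg mult_nonneg_nonneg Dnn)
  qed
  have ubound: "u k $ i \<le> n * c" if "i < n" for k i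
  proof -
    have "u k $ i = (\<Sum>j<n. (D ^\<^sub>m k) $$ (i, j))"
      using that Dk[of k] D by (auto simp: u_eq scalar_prod_def lessThan_atLeast0)
    also have "\<dots> \<le> (\<Sum>j<n. c)"
      by (intro sum_mono) (use entry that in \<open>smt (verit) lessThan_iff\<close>)
    finally show ?thesis by simp
  qed
  define q where "q = r / \<theta>"
  have q: "0 < q" "q < 1" using r by (auto simp: q_def)
  \<comment> \<open>The series may be cut where the next term is sure to be below 1, the value of
    its zeroth term.\<close>
  have "(\<lambda>N. n * c * q ^ N) \<longlonglongrightarrow> n * c * 0"
    using q by (intro tendsto_mult tendsto_const LIMSEQ_power_zero) auto
  then have "\<forall>\<^sub>F N in sequentially. n * c * q ^ N < 1" by (auto dest: order_tendstoD(2)[where a=1])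
  then obtain N where N: "n * c * q ^ N < 1" by (auto simp: eventually_sequentially)
  define v where "v i = (\<Sum>k<Suc N. q ^ k * u k $ i)" for i
  show ?thesis
  proof (rule that)
    fix i assume i: "i < n"
    \<comment> \<open>The zeroth term alone already makes the weight positive.\<close>
    have "v i = u 0 $ i + (\<Sum>k<N. q ^ Suc k * u (Suc k) $ i)"
      unfolding v_def by (subst sum.lessThan_Suc_shift) simp
    moreover have "0 \<le> (\<Sum>k<N. q ^ Suc k * u (Suc k) $ i)"
      using q unn i by (intro sum_nonneg mult_nonneg_nonneg) auto
    ultimately show "0 < v i" using u0 i by simp
    have "(\<Sum>j<n. B $$ (i, j) * v j) = (\<Sum>j<n. \<Sum>k<Suc N. r * q ^ k * (D $$ (i, j) * u k $ j))"
      unfolding v_def by (intro sum.cong refl) (use i BD in \<open>simp add: sum_distrib_left algebra_simps\<close>)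
    also have "\<dots> = (\<Sum>k<Suc N. \<Sum>j<n. r * q ^ k * (D $$ (i, j) * u k $ j))"
      by (rule sum.swap)
    also have "\<dots> = (\<Sum>k<Suc N. \<theta> * (q ^ Suc k * u (Suc k) $ i))"
      using r by (intro sum.cong refl) (simp add: u_Suc i sum_distrib_left q_def)
    also have "\<dots> = \<theta> * (\<Sum>k<Suc N. q ^ Suc k * u (Suc k) $ i)"
      by (simp only: sum_distrib_left)
    \<comment> \<open>Applying B/\<theta> shifts the series by one: the term gained at the end is
      below 1, the zeroth term lost is exactly 1.\<close>
    also have "(\<Sum>k<Suc N. q ^ Suc k * u (Suc k) $ i)
        = (\<Sum>k<Suc (Suc N). q ^ k * u k $ i) - u 0 $ i"
      by (subst (2) sum.lessThan_Suc_shift) simp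
    also have "\<dots> = v i + q ^ Suc N * u (Suc N) $ i - u 0 $ i"
      unfolding v_def by simp
    also have "\<theta> * \<dots> \<le> \<theta> * v i"
    proof -
      have "0 \<le> n * c" using unn[OF i, of 0] ubound[OF i, of 0] by linarith
      have "q ^ Suc N * u (Suc N) $ i \<le> q ^ Suc N * (n * c)"
        using ubound[OF i] q by (intro mult_left_mono) auto
      also have "\<dots> \<le> 1 * (n * c * q ^ N)"
        using q \<open>0 \<le> n * c\<close> by (simp add: mult_left_le_one_le mult.assoc)
      finally show ?thesis using N u0[OF i] r by (intro mult_left_mono) auto
    qed
    finally show "(\<Sum>j<n. B $$ (i, j) * v j) \<le> \<theta> * v i" .
  qed
qed

section \<open>Inverses and determinants of real matrices\<close>

lemma inv_mat_of_det:
  assumes A: "A \<in> carrier_mat n n" and "det A \<noteq> 0"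
  shows "inv_mat A \<in> carrier_mat n n" "A * inv_mat A = 1\<^sub>m n" "inv_mat A * A = 1\<^sub>m n"
proof -
  have "mat_inverse A \<noteq> None"
    using mat_inverse(1)[OF A, of "()"] det_non_zero_imp_unit[OF assms, of "()"] by blast
  then obtain B where "mat_inverse A = Some B" by auto
  then show "inv_mat A \<in> carrier_mat n n" "A * inv_mat A = 1\<^sub>m n" "inv_mat A * A = 1\<^sub>m n"
    using mat_inverse(2)[OF A] unfolding inv_mat_def by auto
qed

lemma invertible_mat_det:
  fixes A :: "real mat"
  assumes A: "A \<in> carrier_mat n n" and "invertible_mat A"
  shows "det A \<noteq> 0"
proof -
  obtain B where AB: "A * B = 1\<^sub>m n" and BA: "B * A = 1\<^sub>m (dim_row B)"
    using assms unfolding invertible_mat_def inverts_mat_def by auto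
  have "dim_col (A * B) = n" "dim_col (B * A) = dim_row B" using AB BA by auto
  then have B: "B \<in> carrier_mat n n" using A by auto
  have "det A * det B = 1" using det_mult[OF A B] AB by simp
  then show ?thesis by auto
qed

subsection \<open>Sign dominance\<close>

lemma finite_arg_max:
  fixes f :: "'a \<Rightarrow> real"
  assumes "finite J" "J \<noteq> {}"
  obtains j where "j \<in> J" "\<And>k. k \<in> J \<Longrightarrow> f k \<le> f j"
proof -
  have "Max (f ` J) \<in> f ` J" using assms by (intro Max_in) auto
  then obtain j where "j \<in> J" "f j = Max (f ` J)" by auto
  then show ?thesis using that[of j] assms by simp
qed

lemma Diag_mult_vec_index:
  assumes "d \<in> carrier_vec n" "x \<in> carrier_vec n" "i < n"
  shows "(Diag d *\<^sub>v x) $ i = d $ i * x $ i"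
proof -
  have "(Diag d *\<^sub>v x) $ i = (\<Sum>j<n. (if i = j then d $ j else 0) * x $ j)"
    using assms by (auto simp: Diag_def mat_diag_def scalar_prod_def lessThan_atLeast0)
  also have "\<dots> = (\<Sum>j<n. if j = i then d $ j * x $ j else 0)"
    by (intro sum.cong) auto
  also have "\<dots> = d $ i * x $ i" using assms by simp
  finally show ?thesis .
qed

text \<open>From here on the spectral radius enters only through the weights: in the maximum norm of
  x_i / v_i the matrix |A^{-1}| has operator norm at most \<theta>.\<close>

locale weighted_contraction =
  fixes n :: nat and A :: "real mat" and v :: "nat \<Rightarrow> real" and \<theta> :: real
  assumes A: "A \<in> carrier_mat n n" and det: "det A \<noteq> 0"
    and weight_pos: "i < n \<Longrightarrow> 0 < v i"
    and row_bound: "i < n \<Longrightarrow> (\<Sum>j<n. \<bar>inv_mat A $$ (i, j)\<bar> * v j) \<le> \<theta> * v i"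
    and theta: "0 \<le> \<theta>" "\<theta> < 1/2"
begin

lemmas inv = inv_mat_of_det[OF A det]

lemma mult_eqD:
  assumes x: "x \<in> carrier_vec n" and "A *\<^sub>v x = y" and i: "i < n"
  shows "x $ i = (\<Sum>j<n. inv_mat A $$ (i, j) * y $ j)"
proof -
  have y: "y \<in> carrier_vec n" using assms A by auto
  have "inv_mat A *\<^sub>v y = (inv_mat A * A) *\<^sub>v x"
    using assms(2) by (simp add: assoc_mult_mat_vec[OF inv(1) A x])
  also have "\<dots> = x" using x by (simp add: inv)
  finally have "x $ i = (inv_mat A *\<^sub>v y) $ i" by simp
  then show ?thesis using i inv(1) y by (auto simp: scalar_prod_def lessThan_atLeast0)
qed

lemma contraction:
  assumes "\<And>j. j < n \<Longrightarrow> \<bar>w j\<bar> \<le> \<delta> * v j" "0 \<le> \<delta>" "i < n"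
  shows "\<bar>\<Sum>j<n. inv_mat A $$ (i, j) * w j\<bar> \<le> \<theta> * \<delta> * v i"
proof -
  have "\<bar>\<Sum>j<n. inv_mat A $$ (i, j) * w j\<bar> \<le> (\<Sum>j<n. \<bar>inv_mat A $$ (i, j)\<bar> * \<bar>w j\<bar>)"
    using sum_abs[of "\<lambda>j. inv_mat A $$ (i, j) * w j" "{..<n}"] by (simp add: abs_mult)
  also have "\<dots> \<le> (\<Sum>j<n. \<bar>inv_mat A $$ (i, j)\<bar> * (\<delta> * v j))"
    using assms by (intro sum_mono mult_left_mono) auto
  also have "\<dots> = \<delta> * (\<Sum>j<n. \<bar>inv_mat A $$ (i, j)\<bar> * v j)"
    by (simp add: sum_distrib_left algebra_simps)
  also have "\<dots> \<le> \<delta> * (\<theta> * v i)"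
    using assms row_bound by (intro mult_left_mono) auto
  finally show ?thesis by (simp add: algebra_simps)
qed

text \<open>
  Terms of \<open>w\<close> that are dominated by \<open>e\<close> itself are absorbed; only the others contribute.
\<close>

lemma implicit_bound:
  assumes e: "\<And>i. i < n \<Longrightarrow> e i = (\<Sum>j<n. inv_mat A $$ (i, j) * w j)"
    and w: "\<And>j. j < n \<Longrightarrow> \<bar>w j\<bar> \<le> \<bar>e j\<bar> \<or> \<bar>w j\<bar> \<le> \<mu> * v j"
    and "0 \<le> \<mu>" "i < n"
  shows "\<bar>e i\<bar> \<le> \<theta> * \<mu> * v i"
proof -
  obtain p where p: "p < n" and pmax: "\<And>k. k < n \<Longrightarrow> \<bar>e k\<bar> / v k \<le> \<bar>e p\<bar> / v p"
    using finite_arg_max[of "{..<n}" "\<lambda>k. \<bar>e k\<bar> / v k"] \<open>i < n\<close> by auto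
  define \<epsilon> where "\<epsilon> = \<bar>e p\<bar> / v p"
  have eps: "\<bar>e k\<bar> \<le> \<epsilon> * v k" if "k < n" for k
    using pmax[OF that] weight_pos[OF that] by (simp add: \<epsilon>_def field_simps)
  have eps0: "0 \<le> \<epsilon>" using weight_pos[OF p] by (simp add: \<epsilon>_def)
  have "\<bar>w j\<bar> \<le> max \<epsilon> \<mu> * v j" if j: "j < n" for j
  proof -
    have "\<epsilon> * v j \<le> max \<epsilon> \<mu> * v j" "\<mu> * v j \<le> max \<epsilon> \<mu> * v j"
      using weight_pos[OF j] by (auto intro!: mult_right_mono)
    then show ?thesis using w[OF j] eps[OF j] by linarith
  qed
  then have "\<bar>e p\<bar> \<le> \<theta> * max \<epsilon> \<mu> * v p"
    unfolding e[OF p] using eps0 p by (intro contraction) auto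
  then have *: "\<epsilon> \<le> \<theta> * max \<epsilon> \<mu>"
    using weight_pos[OF p] by (simp add: \<epsilon>_def field_simps)
  \<comment> \<open>The case \<epsilon> > \<mu> is impossible: it would give \<epsilon> \<le>
    \<theta> \<epsilon> \<le> \<epsilon>/2, hence \<epsilon> \<le> 0 \<le> \<mu>.\<close>
  have "\<theta> * \<epsilon> \<le> 1/2 * \<epsilon>" using theta eps0 by (intro mult_right_mono) auto
  then have "\<epsilon> \<le> \<theta> * \<mu>"
    using * eps0 \<open>0 \<le> \<mu>\<close> by (cases "\<epsilon> \<le> \<mu>") (auto simp: max_def split: if_splits)
  then have "\<epsilon> * v i \<le> \<theta> * \<mu> * v i"
    using weight_pos[OF \<open>i < n\<close>] by (intro mult_right_mono) auto
  then show ?thesis using eps[OF \<open>i < n\<close>] by linarith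
qed

text \<open>The case \<mu> = 0 of \<open>implicit_bound\<close>. It yields both the nonsingularity
  of \<open>A - Diag d\<close> and the uniqueness of solutions.\<close>

lemma implicit_zero:
  assumes "\<And>i. i < n \<Longrightarrow> e i = (\<Sum>j<n. inv_mat A $$ (i, j) * w j)"
    and "\<And>j. j < n \<Longrightarrow> \<bar>w j\<bar> \<le> \<bar>e j\<bar>" and "i < n"
  shows "e i = 0"
  using implicit_bound[of e w 0 i] assms by auto

text \<open>A kernel vector x of \<open>A - Diag d\<close> satisfies x = A^{-1} (Diag d x) with |d_j
  x_j| \<le> |x_j|, so \<open>implicit_zero\<close> kills it. Entries of d range over [-1,1] because
  the reference vector in \<open>sign_dominance\<close> has zeros.\<close>

lemma iterate_solves:
  assumes d: "d \<in> carrier_vec n" "\<And>j. j < n \<Longrightarrow> \<bar>d $ j\<bar> \<le> 1" and b: "b \<in> carrier_vec n"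
  shows "iterate A b d \<in> carrier_vec n" "A *\<^sub>v iterate A b d - Diag d *\<^sub>v iterate A b d = b"
proof -
  have Dd: "Diag d \<in> carrier_mat n n" using d by (auto simp: Diag_def)
  have AD: "A - Diag d \<in> carrier_mat n n" by (rule minus_carrier_mat[OF Dd])
  have "det (A - Diag d) \<noteq> 0"
  proof
    assume "det (A - Diag d) = 0"
    then obtain x where x: "x \<in> carrier_vec n" "x \<noteq> 0\<^sub>v n" "(A - Diag d) *\<^sub>v x = 0\<^sub>v n"
      using det_0_iff_vec_prod_zero_field[OF AD] by auto
    have "A *\<^sub>v x - Diag d *\<^sub>v x = 0\<^sub>v n"
      using x minus_mult_distrib_mat_vec[OF A Dd x(1)] by simp
    then have "(A *\<^sub>v x - Diag d *\<^sub>v x) $ i = 0" if "i < n" for i using that by simp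
    then have "A *\<^sub>v x = Diag d *\<^sub>v x"
      using A Dd by (intro eq_vecI) auto
    then have x_eq: "x $ i = (\<Sum>j<n. inv_mat A $$ (i, j) * (d $ j * x $ j))" if "i < n" for i
      using mult_eqD[OF x(1) _ that] Diag_mult_vec_index[OF d(1) x(1)] by simp
    have le: "\<bar>d $ j * x $ j\<bar> \<le> \<bar>x $ j\<bar>" if "j < n" for j
      using d(2)[OF that] by (simp add: abs_mult mult_left_le_one_le)
    have "x $ i = 0" if "i < n" for i
      by (rule implicit_zero[of "\<lambda>i. x $ i" "\<lambda>j. d $ j * x $ j", OF x_eq le that])
    then have "x = 0\<^sub>v n" using x by (intro eq_vecI) auto
    then show False using x by simp
  qed
  note inverse = inv_mat_of_det[OF AD this]
  show it: "iterate A b d \<in> carrier_vec n" using inverse b by (simp add: iterate_def)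
  have "(A - Diag d) *\<^sub>v iterate A b d = b"
    unfolding iterate_def using b
    by (simp add: assoc_mult_mat_vec[OF AD inverse(1) b, symmetric] inverse)
  then show "A *\<^sub>v iterate A b d - Diag d *\<^sub>v iterate A b d = b"
    using minus_mult_distrib_mat_vec[OF A Dd it] by simp
qed

text \<open>The matrix on the right is A^{-1} whatever d is, so the equations of two different
  iterates can be subtracted.\<close>

lemma iterate_fixpoint:
  assumes d: "d \<in> carrier_vec n" "\<And>j. j < n \<Longrightarrow> \<bar>d $ j\<bar> \<le> 1" and b: "b \<in> carrier_vec n"
    and i: "i < n"
  shows "iterate A b d $ i = (\<Sum>j<n. inv_mat A $$ (i, j) * (b $ j + d $ j * iterate A b d $ j))"
proof -
  let ?x = "iterate A b d"
  note x = iterate_solves[OF d b]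
  have Dx: "Diag d *\<^sub>v ?x \<in> carrier_vec n"
    using d by (intro mult_mat_vec_carrier[OF _ x(1)]) (auto simp: Diag_def)
  have Ax: "A *\<^sub>v ?x \<in> carrier_vec n" by (rule mult_mat_vec_carrier[OF A x(1)])
  have "(A *\<^sub>v ?x) $ j = b $ j + d $ j * ?x $ j" if "j < n" for j
  proof -
    have "(A *\<^sub>v ?x - Diag d *\<^sub>v ?x) $ j = b $ j" using x(2) by simp
    then have "(A *\<^sub>v ?x) $ j - (Diag d *\<^sub>v ?x) $ j = b $ j"
      using that Dx Ax by (simp only: index_minus_vec carrier_vecD)
    then show ?thesis using Diag_mult_vec_index[OF d(1) x(1) that] by linarith
  qed
  then show ?thesis using mult_eqD[OF x(1) refl i] by simp
qed

text \<open>The prescribed signs on \<open>F\<close> are arbitrary; they need not be the signs of the solution.\<close>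

lemma sign_dominance:
  assumes z: "z \<in> sign_vecs n" and b: "b \<in> carrier_vec n" and "p < n" "p \<notin> F"
  obtains j s where "j < n" "j \<notin> F"
    "\<And>z'. z' \<in> sign_vecs n \<Longrightarrow> (\<And>i. i \<in> F \<Longrightarrow> i < n \<Longrightarrow> z' $ i = z $ i) \<Longrightarrow> sgn (iterate A b z' $ j) = s"
    "\<And>z' k. z' \<in> sign_vecs n \<Longrightarrow> (\<And>i. i \<in> F \<Longrightarrow> i < n \<Longrightarrow> z' $ i = z $ i) \<Longrightarrow> s = 0 \<Longrightarrow>
       k < n \<Longrightarrow> k \<notin> F \<Longrightarrow> iterate A b z' $ k = 0"
proof -
  define J where "J = {i. i < n \<and> i \<notin> F}"
  have J: "finite J" "J \<noteq> {}" using assms by (auto simp: J_def)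
  \<comment> \<open>Zeros outside F make c depend on the prescribed signs alone; it is the common
    reference for all completions z'.\<close>
  define d where "d = vec n (\<lambda>i. if i \<in> F then z $ i else 0)"
  define c where "c = iterate A b d"
  have d: "d \<in> carrier_vec n" "\<And>j. j < n \<Longrightarrow> \<bar>d $ j\<bar> \<le> 1"
    using z by (auto simp: d_def sign_vecs_def)
  obtain j where j: "j \<in> J" and jmax: "\<And>k. k \<in> J \<Longrightarrow> \<bar>c $ k\<bar> / v k \<le> \<bar>c $ j\<bar> / v j"
    using finite_arg_max[OF J, of "\<lambda>k. \<bar>c $ k\<bar> / v k"] by blast
  have jn: "j < n" "j \<notin> F" using j by (auto simp: J_def)
  define \<gamma> where "\<gamma> = \<bar>c $ j\<bar> / v j"
  have gam0: "0 \<le> \<gamma>" using weight_pos[OF jn(1)] by (simp add: \<gamma>_def)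
  have main: "sgn (iterate A b z' $ j) = sgn (c $ j) \<and>
      (sgn (c $ j) = 0 \<longrightarrow> (\<forall>k\<in>J. iterate A b z' $ k = 0))"
    if z': "z' \<in> sign_vecs n" and agree: "\<And>i. i \<in> F \<Longrightarrow> i < n \<Longrightarrow> z' $ i = z $ i" for z'
  proof -
    have z'c: "z' \<in> carrier_vec n" "\<And>j. j < n \<Longrightarrow> \<bar>z' $ j\<bar> = 1"
      using z' by (auto simp: sign_vecs_def)
    define x where "x = iterate A b z'"
    define e where "e k = x $ k - c $ k" for k
    define w where "w k = z' $ k * x $ k - d $ k * c $ k" for k
    obtain q where q: "q \<in> J" and qmax: "\<And>k. k \<in> J \<Longrightarrow> \<bar>x $ k\<bar> / v k \<le> \<bar>x $ q\<bar> / v q"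
      using finite_arg_max[OF J, of "\<lambda>k. \<bar>x $ k\<bar> / v k"] by blast
    have qn: "q < n" using q by (auto simp: J_def)
    define \<mu> where "\<mu> = \<bar>x $ q\<bar> / v q"
    have mu0: "0 \<le> \<mu>" using weight_pos[OF qn] by (simp add: \<mu>_def)
    have xmu: "\<bar>x $ k\<bar> \<le> \<mu> * v k" if "k \<in> J" for k
      using qmax[OF that] weight_pos[of k] that by (simp add: \<mu>_def J_def field_simps)
    have e_eq: "e k = (\<Sum>i<n. inv_mat A $$ (k, i) * w i)" if k: "k < n" for k
    proof -
      have x_eq: "x $ k = (\<Sum>i<n. inv_mat A $$ (k, i) * (b $ i + z' $ i * x $ i))"
        unfolding x_def by (rule iterate_fixpoint[OF z'c(1) _ b k]) (simp add: z'c)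
      have c_eq: "c $ k = (\<Sum>i<n. inv_mat A $$ (k, i) * (b $ i + d $ i * c $ i))"
        unfolding c_def by (rule iterate_fixpoint[OF d b k])
      show ?thesis
        unfolding e_def by (subst x_eq, subst c_eq)
          (simp add: sum_subtractf[symmetric] w_def right_diff_distrib[symmetric])
    qed
    \<comment> \<open>On F the vectors z' and d agree, so |w i| = |e i|; off F the entry of d is 0
      and |w i| = |x_i| is controlled by \<mu>. These are the two alternatives of
      \<open>implicit_bound\<close>.\<close>
    have w: "\<bar>w i\<bar> \<le> \<bar>e i\<bar> \<or> \<bar>w i\<bar> \<le> \<mu> * v i" if i: "i < n" for i
    proof (cases "i \<in> F")
      case True
      then have "w i = z' $ i * e i"
        using agree[OF True i] i by (simp add: w_def e_def d_def algebra_simps)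
      then show ?thesis using z'c(2)[OF i] by (simp add: abs_mult)
    next
      case False
      then have "\<bar>w i\<bar> = \<bar>x $ i\<bar>" using i z'c(2)[OF i] by (simp add: w_def d_def abs_mult)
      then show ?thesis using xmu[of i] False i by (simp add: J_def)
    qed
    have e_bound: "\<bar>e k\<bar> \<le> \<theta> * \<mu> * v k" if "k < n" for k
      by (rule implicit_bound[OF e_eq w mu0 that])
    \<comment> \<open>Triangle inequality at q, where the weighted |x| is largest outside F.\<close>
    have "\<mu> \<le> \<gamma> + \<theta> * \<mu>"
    proof -
      have "\<bar>x $ q\<bar> \<le> \<bar>c $ q\<bar> + \<theta> * \<mu> * v q" using e_bound[OF qn] by (simp add: e_def)
      then have "\<mu> \<le> \<bar>c $ q\<bar> / v q + \<theta> * \<mu>"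
        using weight_pos[OF qn] by (simp add: \<mu>_def field_simps)
      then show ?thesis using jmax[OF q] by (simp add: \<gamma>_def)
    qed
    then have mu_gam: "(1 - \<theta>) * \<mu> \<le> \<gamma>" by (simp add: algebra_simps)
    have ej: "\<bar>e j\<bar> \<le> \<theta> * \<mu> * v j" by (rule e_bound[OF jn(1)])
    show ?thesis
    proof (cases "c $ j = 0")
      \<comment> \<open>A zero of c at the dominant index forces \<mu> = 0, so the iterate of every
        completion vanishes outside F.\<close>
      case True
      then have "(1 - \<theta>) * \<mu> \<le> 0" using mu_gam by (simp add: \<gamma>_def)
      then have "\<mu> = 0" using mu0 theta by (simp add: mult_le_0_iff)
      then have "x $ k = 0" if "k \<in> J" for k using xmu[OF that] by simp
      then show ?thesis using True j by (simp add: x_def)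
    next
      case False
      then have gam: "0 < \<gamma>" using weight_pos[OF jn(1)] by (simp add: \<gamma>_def)
      \<comment> \<open>Here \<theta> < 1/2 is used as \<theta> < 1 - \<theta>: the deviation at j
        is strictly smaller than |c_j| and cannot change its sign.\<close>
      have "\<theta> * \<mu> < \<gamma>"
      proof (cases "\<mu> = 0")
        case False
        then have "\<theta> * \<mu> < (1 - \<theta>) * \<mu>" using mu0 theta by (intro mult_strict_right_mono) auto
        then show ?thesis using mu_gam by linarith
      qed (use gam in simp)
      then have "\<theta> * \<mu> * v j < \<bar>c $ j\<bar>" using weight_pos[OF jn(1)] by (simp add: \<gamma>_def field_simps)
      then have "\<bar>x $ j - c $ j\<bar> < \<bar>c $ j\<bar>" using ej by (simp add: e_def)
      then have "sgn (x $ j) = sgn (c $ j)" by (auto simp: sgn_if)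
      then show ?thesis using False by (simp add: x_def sgn_0_0)
    qed
  qed
  show ?thesis
    by (rule that[OF jn, of "sgn (c $ j)"]) (use main in \<open>auto simp: J_def\<close>)
qed

end

subsection \<open>Runs of the sign-flip algorithm\<close>

lemma flip_index: "i < dim_vec z \<Longrightarrow> flip S z $ i = (if i \<in> S then - z $ i else z $ i)"
  by (simp add: flip_def)

lemma flip_sign_vecs: "z \<in> sign_vecs n \<Longrightarrow> flip S z \<in> sign_vecs n"
  by (fastforce simp: sign_vecs_def flip_def)

lemma finite_mismatch [simp]: "finite (mismatch A b z)"
  by (simp add: mismatch_def)

section \<open>Uniformly random subsets of prescribed size\<close>

lemma subsets_card_nonempty:
  assumes "finite V" "k \<le> card V"
  shows "finite {S. S \<subseteq> V \<and> card S = k}" "{S. S \<subseteq> V \<and> card S = k} \<noteq> {}"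
  using assms obtain_subset_with_card_n[of k V] by (auto intro: rev_finite_subset[of "Pow V"])

lemma set_random_flip_rule:
  assumes "finite V"
  shows "set_pmf (random_flip_rule m V) = {S. S \<subseteq> V \<and> card S = min m (card V)}"
  unfolding random_flip_rule_def
  using subsets_card_nonempty[OF assms, of "min m (card V)"] by (intro set_pmf_of_set) auto

text \<open>The form matches the assumption on a general \<open>rule\<close> under which termination
  and correctness are proved below.\<close>

lemma random_flip_rule_nonempty:
  assumes "0 < m"
  shows "\<forall>V. finite V \<longrightarrow> V \<noteq> {} \<longrightarrow> (\<forall>S \<in> set_pmf (random_flip_rule m V). S \<subseteq> V \<and> S \<noteq> {})"
proof (intro allI impI ballI)
  fix V S assume V: "finite V" "V \<noteq> {}" and S: "S \<in> set_pmf (random_flip_rule m V)"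
  have "0 < min m (card V)" using V assms by (simp add: card_gt_0_iff)
  then show "S \<subseteq> V \<and> S \<noteq> {}" using S V by (auto simp: set_random_flip_rule)
qed

text \<open>Removing j is a bijection onto the subsets of \<open>V - {j}\<close> of size k -
  1.\<close>

lemma card_subsets_containing:
  assumes "finite V" "j \<in> V" "0 < k"
  shows "card {S. S \<subseteq> V \<and> card S = k \<and> j \<in> S} = (card V - 1) choose (k - 1)"
proof -
  have "{S. S \<subseteq> V \<and> card S = k \<and> j \<in> S} = insert j ` {T. T \<subseteq> V - {j} \<and> card T = k - 1}"
  proof (intro equalityI subsetI)
    fix S assume "S \<in> {S. S \<subseteq> V \<and> card S = k \<and> j \<in> S}"
    then have "S = insert j (S - {j})" "S - {j} \<in> {T. T \<subseteq> V - {j} \<and> card T = k - 1}" by auto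
    then show "S \<in> insert j ` {T. T \<subseteq> V - {j} \<and> card T = k - 1}" by blast
  next
    fix S assume "S \<in> insert j ` {T. T \<subseteq> V - {j} \<and> card T = k - 1}"
    then obtain T where T: "S = insert j T" "T \<subseteq> V - {j}" "card T = k - 1" by auto
    moreover have "finite T" using T(2) assms(1) by (rule finite_subset[OF _ finite_Diff])
    ultimately show "S \<in> {S. S \<subseteq> V \<and> card S = k \<and> j \<in> S}"
      using assms by (auto simp: card_insert_if)
  qed
  moreover have "inj_on (insert j) {T. T \<subseteq> V - {j} \<and> card T = k - 1}"
    by (auto simp: inj_on_def)
  ultimately show ?thesis using assms by (simp add: card_image n_subsets)
qed

text \<open>A quotient of two counts, simplified by the absorption identity k C(N,k) = N
  C(N-1,k-1).\<close>

lemma prob_random_flip_rule: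
  assumes V: "finite V" "j \<in> V" and m: "0 < m"
  shows "measure_pmf.prob (random_flip_rule m V) {S. j \<in> S} = min m (card V) / card V"
proof -
  let ?k = "min m (card V)"
  have pos: "0 < card V" using V card_gt_0_iff by blast
  note ne = subsets_card_nonempty[OF V(1), of ?k]
  have "measure_pmf.prob (random_flip_rule m V) {S. j \<in> S}
      = card {S. S \<subseteq> V \<and> card S = ?k \<and> j \<in> S} / card {S. S \<subseteq> V \<and> card S = ?k}"
    unfolding random_flip_rule_def using ne
    by (subst measure_pmf_of_set) (auto simp: Collect_conj_eq Int_assoc)
  also have "\<dots> = ((card V - 1) choose (?k - 1)) / (card V choose ?k)"
    using V pos m by (subst card_subsets_containing) (auto simp: n_subsets)
  also have "\<dots> = ?k / card V"
  proof -
    have "?k * (card V choose ?k) = card V * ((card V - 1) choose (?k - 1))"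
      using m pos by (intro times_binomial_minus1_eq) auto
    then have "real ?k * (card V choose ?k) = card V * ((card V - 1) choose (?k - 1))"
      by (metis of_nat_mult)
    moreover have "0 < card V choose ?k" by simp
    ultimately show ?thesis using pos by (simp add: field_simps)
  qed
  finally show ?thesis .
qed

section \<open>Unfolding one pass of the loop\<close>

lemma sign_flip_done:
  "mismatch A b z = {} \<Longrightarrow> sign_flip rule A b z = return_spmf (iterate A b z, 0)"
  by (subst sign_flip.simps) simp

lemma sign_flip_continue:
  "mismatch A b z \<noteq> {} \<Longrightarrow> sign_flip rule A b z =
     bind_pmf (rule (mismatch A b z))
       (\<lambda>S. map_spmf (\<lambda>(x, k). (x, Suc k)) (sign_flip rule A b (flip S z)))"
  by (subst sign_flip.simps) simp

text \<open>The additional pass is weighted by the total mass of the remaining run, which is at most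
  1; hence an inequality that can be stated before losslessness is known.\<close>

lemma expected_iterations_continue:
  assumes "mismatch A b z \<noteq> {}"
  shows "expected_iterations (sign_flip rule A b z)
    \<le> (\<integral>\<^sup>+ S. 1 + expected_iterations (sign_flip rule A b (flip S z)) \<partial>rule (mismatch A b z))"
proof -
  let ?p = "\<lambda>S. sign_flip rule A b (flip S z)"
  have "expected_iterations (sign_flip rule A b z) =
    (\<integral>\<^sup>+ S. \<integral>\<^sup>+ r. of_nat (snd r) \<partial>measure_spmf (map_spmf (\<lambda>(x, k). (x, Suc k)) (?p S))
       \<partial>rule (mismatch A b z))"
    unfolding expected_iterations_def sign_flip_continue[of A b z rule, OF assms] measure_spmf_bind_pmf comp_def
    by (intro nn_integral_bind[where B = "count_space UNIV"]) (auto simp: space_subprob_algebra subprob_space_measure_spmf)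
  also have "\<dots> = (\<integral>\<^sup>+ S. \<integral>\<^sup>+ r. 1 + of_nat (snd r) \<partial>measure_spmf (?p S) \<partial>rule (mismatch A b z))"
    by (simp add: comp_def split_def)
  also have "\<dots> \<le> (\<integral>\<^sup>+ S. 1 + expected_iterations (?p S) \<partial>rule (mismatch A b z))"
  proof (rule nn_integral_mono)
    fix S
    have "(\<integral>\<^sup>+ r. 1 + of_nat (snd r) \<partial>measure_spmf (?p S))
        = emeasure (measure_spmf (?p S)) UNIV + expected_iterations (?p S)"
      by (subst nn_integral_add) (auto simp: expected_iterations_def space_measure_spmf)
    also have "\<dots> \<le> 1 + expected_iterations (?p S)"
      by (intro add_right_mono measure_spmf.subprob_emeasure_le_1)
    finally show "(\<integral>\<^sup>+ r. 1 + of_nat (snd r) \<partial>measure_spmf (?p S)) \<le> 1 + expected_iterations (?p S)" .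
  qed
  finally show ?thesis .
qed

section \<open>Termination and correctness of every run\<close>

context weighted_contraction
begin

context
  fixes b :: "real vec"
  assumes b: "b \<in> carrier_vec n"
begin

lemma iterate_sign_vec:
  assumes z: "z \<in> sign_vecs n"
  shows "iterate A b z \<in> carrier_vec n" "A *\<^sub>v iterate A b z - Diag z *\<^sub>v iterate A b z = b"
proof -
  have "z \<in> carrier_vec n" "\<And>j. j < n \<Longrightarrow> \<bar>z $ j\<bar> \<le> 1"
    using z by (auto simp: sign_vecs_def)
  from iterate_solves[OF this b]
  show "iterate A b z \<in> carrier_vec n" "A *\<^sub>v iterate A b z - Diag z *\<^sub>v iterate A b z = b" by auto
qed

lemma mismatch_iff:
  assumes "z \<in> sign_vecs n"
  shows "i \<in> mismatch A b z \<longleftrightarrow> i < n \<and> z $ i * iterate A b z $ i < 0"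
  using assms by (auto simp: mismatch_def sign_vecs_def)

text \<open>When no signs disagree, \<open>Diag z\<close> acts on the iterate as the entrywise
  absolute value.\<close>

lemma ave_solution_iterate:
  assumes z: "z \<in> sign_vecs n" and no_mismatch: "mismatch A b z = {}"
  shows "ave_solution A b (iterate A b z)"
proof -
  let ?x = "iterate A b z"
  have zc: "z \<in> carrier_vec n" using z by (simp add: sign_vecs_def)
  note x = iterate_sign_vec[OF z]
  have "abs_vec ?x $ i = (Diag z *\<^sub>v ?x) $ i" if i: "i < n" for i
  proof -
    have "0 \<le> z $ i * ?x $ i" using no_mismatch mismatch_iff[OF z, of i] i by auto
    moreover have "\<bar>z $ i\<bar> = 1" using z i by (auto simp: sign_vecs_def)
    ultimately have "z $ i * ?x $ i = \<bar>?x $ i\<bar>" by (metis abs_mult abs_of_nonneg mult_1)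
    then show ?thesis using Diag_mult_vec_index[OF zc x(1) i] x(1) i by (simp add: abs_vec_def)
  qed
  then have "abs_vec ?x = Diag z *\<^sub>v ?x"
    using x(1) zc by (intro eq_vecI) (auto simp: abs_vec_def Diag_def mat_diag_def)
  then show ?thesis using x A by (simp add: ave_solution_def)
qed

text \<open>Two solutions satisfy ||x_j| - |y_j|| \<le> |x_j - y_j|, so \<open>implicit_zero\<close>
  applies to their difference.\<close>

lemma ave_solution_unique:
  assumes "ave_solution A b x" "ave_solution A b y"
  shows "x = y"
proof -
  have x_eq: "x \<in> carrier_vec n"
    "\<And>i. i < n \<Longrightarrow> x $ i = (\<Sum>j<n. inv_mat A $$ (i, j) * (b $ j + \<bar>x $ j\<bar>))"
    if "ave_solution A b x" for x
  proof -
    show x: "x \<in> carrier_vec n" using that A by (auto simp: ave_solution_def)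
    have eq: "A *\<^sub>v x - abs_vec x = b" using that by (simp add: ave_solution_def)
    have Ax: "A *\<^sub>v x \<in> carrier_vec n" by (rule mult_mat_vec_carrier[OF A x])
    have abs: "abs_vec x \<in> carrier_vec n" using x by (simp add: abs_vec_def)
    have "(A *\<^sub>v x) $ j = b $ j + \<bar>x $ j\<bar>" if j: "j < n" for j
    proof -
      have "(A *\<^sub>v x) $ j - abs_vec x $ j = b $ j"
        using j Ax abs by (subst eq[symmetric]) (simp only: index_minus_vec carrier_vecD)
      then show ?thesis using j x by (simp add: abs_vec_def)
    qed
    then show "x $ i = (\<Sum>j<n. inv_mat A $$ (i, j) * (b $ j + \<bar>x $ j\<bar>))" if "i < n" for i
      using mult_eqD[OF x refl that] by simp
  qed
  have diff: "x $ i - y $ i = (\<Sum>j<n. inv_mat A $$ (i, j) * (\<bar>x $ j\<bar> - \<bar>y $ j\<bar>))" if i: "i < n" for i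
    by (subst x_eq(2)[OF assms(1) i], subst x_eq(2)[OF assms(2) i])
      (simp add: sum_subtractf[symmetric] right_diff_distrib[symmetric])
  have "x $ i - y $ i = 0" if i: "i < n" for i
    by (rule implicit_zero[of "\<lambda>i. x $ i - y $ i" "\<lambda>j. \<bar>x $ j\<bar> - \<bar>y $ j\<bar>", OF diff _ i]) auto
  then show ?thesis using x_eq(1)[OF assms(1)] x_eq(1)[OF assms(2)] by (intro eq_vecI) auto
qed

text \<open>Purely deterministic: the selections are arbitrary nonempty sets of mismatches.\<close>

lemma no_infinite_flips:
  assumes z: "\<And>k. zs k \<in> sign_vecs n"
    and S: "\<And>k. S k \<subseteq> mismatch A b (zs k)" "\<And>k. S k \<noteq> {}"
    and step: "\<And>k. zs (Suc k) = flip (S k) (zs k)"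
  shows False
proof -
  define F where "F = {i. i < n \<and> finite {k. i \<in> S k}}"
  have zc: "dim_vec (zs k) = n" for k using z[of k] by (auto simp: sign_vecs_def)
  have step_index: "zs (Suc k) $ i = (if i \<in> S k then - zs k $ i else zs k $ i)" if "i < n" for i k
    using that by (simp add: step flip_index zc)
  have "finite (\<Union>i\<in>F. {k. i \<in> S k})" by (auto simp: F_def)
  \<comment> \<open>Altogether the indices of F are flipped only finitely often, so their signs are
    frozen from some time K on.\<close>
  then obtain K where K: "\<forall>k \<in> (\<Union>i\<in>F. {k. i \<in> S k}). k < K"
    unfolding finite_nat_set_iff_bounded by (rule exE)
  have unflipped: "i \<notin> S k" if "i \<in> F" "K \<le> k" for i k
    using K that by force
  have agree: "zs k $ i = zs K $ i" if "K \<le> k" "i \<in> F" for k i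
    using that(1)
  proof (induction k rule: dec_induct)
    case (step k)
    then show ?case using step_index[of i k] unflipped[OF that(2)] that(2) by (simp add: F_def)
  qed simp
  \<comment> \<open>\<open>sign_dominance\<close> needs an index outside F; one that is flipped at
    time K qualifies.\<close>
  obtain p where p: "p \<in> S K" using S(2)[of K] by auto
  then have "p < n" using S(1)[of K] mismatch_iff[OF z] by auto
  moreover have "p \<notin> F" using unflipped[of p K] p by auto
  ultimately obtain j s where j: "j < n" "j \<notin> F"
    and sgn: "\<And>k. K \<le> k \<Longrightarrow> sgn (iterate A b (zs k) $ j) = s"
    using sign_dominance[OF z[of K] b, of p F] z agree by metis
  have inf: "infinite {k. j \<in> S k}" using j by (simp add: F_def)
  then obtain k1 where k1: "K \<le> k1" "j \<in> S k1"
    by (metis (mono_tags) infinite_nat_iff_unbounded_le mem_Collect_eq)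
  \<comment> \<open>Since j is a mismatch at k1, s is nonzero and the flip makes the sign at j agree
    with s. As s stays the sign of the iterate at j, this index is never a mismatch again.\<close>
  have "0 < zs k $ j * s" if "Suc k1 \<le> k" for k
    using that
  proof (induction k rule: dec_induct)
    case base
    have "zs k1 $ j * iterate A b (zs k1) $ j < 0"
      using k1 S(1)[of k1] mismatch_iff[OF z] by auto
    then show ?case using step_index[OF j(1), of k1] k1 sgn[OF k1(1)]
      by (auto simp: sgn_if mult_less_0_iff split: if_splits)
  next
    case (step k)
    then have "0 < zs k $ j * iterate A b (zs k) $ j"
      using sgn[of k] k1(1) by (auto simp: sgn_if zero_less_mult_iff split: if_splits)
    then have "j \<notin> S k" using S(1)[of k] mismatch_iff[OF z] by auto
    then show ?case using step step_index[OF j(1)] by simp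
  qed note pos = this
  have "j \<notin> S k" if "Suc k1 \<le> k" for k
  proof -
    have "0 < zs k $ j * iterate A b (zs k) $ j"
      using pos[OF that] sgn[of k] k1(1) that
      by (auto simp: sgn_if zero_less_mult_iff split: if_splits)
    then show ?thesis using S(1)[of k] mismatch_iff[OF z] by auto
  qed
  then have "{k. j \<in> S k} \<subseteq> {..k1}" by (auto simp: not_less_eq_eq[symmetric])
  then show False using inf finite_subset by blast
qed

context
  fixes rule :: "nat set \<Rightarrow> nat set pmf"
  assumes rule: "\<forall>V. finite V \<longrightarrow> V \<noteq> {} \<longrightarrow> (\<forall>S \<in> set_pmf (rule V). S \<subseteq> V \<and> S \<noteq> {})"
begin

lemma no_infinite_run:
  assumes z: "zs 0 \<in> sign_vecs n" and step: "\<And>k. sign_flip_step rule A b (zs k) (zs (Suc k))"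
  shows False
proof -
  have "\<exists>S. S \<subseteq> mismatch A b (zs k) \<and> S \<noteq> {} \<and> zs (Suc k) = flip S (zs k)" for k
    using step[of k] rule finite_mismatch unfolding sign_flip_step_def by metis
  then obtain S where S: "\<And>k. S k \<subseteq> mismatch A b (zs k)" "\<And>k. S k \<noteq> {}"
    "\<And>k. zs (Suc k) = flip (S k) (zs k)" by metis
  have "zs k \<in> sign_vecs n" for k
    by (induction k) (simp_all add: z S(3) flip_sign_vecs)
  from no_infinite_flips[of zs S, OF this S] show False .
qed

text \<open>Absence of infinite runs is well-foundedness of the step relation. The induction drives
  both correctness and the bound on the expectation.\<close>

lemma sign_flip_induct [consumes 1, case_names step]:
  assumes "z \<in> sign_vecs n"
    and step: "\<And>z. z \<in> sign_vecs n \<Longrightarrow>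
      (\<And>S. mismatch A b z \<noteq> {} \<Longrightarrow> S \<in> set_pmf (rule (mismatch A b z)) \<Longrightarrow> P (flip S z)) \<Longrightarrow> P z"
  shows "P z"
proof -
  define R where "R = {(z', z). z \<in> sign_vecs n \<and> sign_flip_step rule A b z z'}"
  have "wf R"
    unfolding wf_iff_no_infinite_down_chain R_def using no_infinite_run by blast
  then show ?thesis using assms(1)
  proof (induction z)
    case (less z)
    show ?case
    proof (rule step[OF less.prems])
      fix S assume "mismatch A b z \<noteq> {}" "S \<in> set_pmf (rule (mismatch A b z))"
      then have "(flip S z, z) \<in> R" using less.prems by (auto simp: R_def sign_flip_step_def)
      then show "P (flip S z)" using less.IH flip_sign_vecs[OF less.prems] by blast
    qed
  qed
qed

text \<open>A run is lossless once all its possible continuations are, so losslessness follows by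
  the induction without any probability estimate.\<close>

lemma sign_flip_correct:
  assumes "z \<in> sign_vecs n"
  shows "lossless_spmf (sign_flip rule A b z) \<and>
    (\<forall>(x, k) \<in> set_spmf (sign_flip rule A b z). ave_solution A b x)"
  using assms
proof (induction z rule: sign_flip_induct)
  case (step z)
  show ?case
  proof (cases "mismatch A b z = {}")
    case True
    then show ?thesis using ave_solution_iterate[OF step(1)] by (simp add: sign_flip_done)
  next
    case False
    have "lossless_spmf (sign_flip rule A b z)"
      using step(2)[OF False] by (simp add: sign_flip_continue[OF False])
    moreover have "\<forall>(x, k) \<in> set_spmf (sign_flip rule A b z). ave_solution A b x"
      using step(2)[OF False]
      by (fastforce simp: sign_flip_continue[OF False] set_spmf_bind_pmf bind_UNION)
    ultimately show ?thesis by simp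
  qed
qed

end

section \<open>Settled sets and the expected number of iterations\<close>

definition settled :: "real vec \<Rightarrow> nat set \<Rightarrow> bool" where
  "settled z F \<longleftrightarrow> F \<subseteq> {..<n} \<and>
     (\<forall>z' \<in> sign_vecs n. (\<forall>i\<in>F. z' $ i = z $ i) \<longrightarrow> mismatch A b z' \<inter> F = {})"

text \<open>The empty set is settled and all settled sets lie in \<open>{..<n}\<close>, so the
  maximum is over a finite nonempty set.\<close>

definition max_settled :: "real vec \<Rightarrow> nat" where
  "max_settled z = Max (card ` {F. settled z F})"

lemma finite_settled: "finite {F. settled z F}"
  by (rule finite_subset[of _ "Pow {..<n}"]) (auto simp: settled_def)

lemma settled_card_le: "settled z F \<Longrightarrow> card F \<le> max_settled z"
  unfolding max_settled_def using finite_settled by (intro Max_ge) auto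

lemma max_settled_witness:
  obtains F where "settled z F" "card F = max_settled z"
proof -
  have "settled z {}" by (simp add: settled_def)
  then have "max_settled z \<in> card ` {F. settled z F}"
    unfolding max_settled_def using finite_settled by (intro Max_in) auto
  then show ?thesis using that by auto
qed

lemma max_settled_le: "max_settled z \<le> n"
proof -
  obtain F where F: "settled z F" "card F = max_settled z" by (rule max_settled_witness)
  then have "card F \<le> card {..<n}" by (intro card_mono) (auto simp: settled_def)
  then show ?thesis using F by simp
qed

text \<open>As z agrees with itself on F, there is no mismatch in F and the flip leaves the signs on
  F alone. \<open>settled\<close> ranges over all completions and thus sees z only through these
  signs, so it persists.\<close>

lemma settled_flip:
  assumes z: "z \<in> sign_vecs n" and F: "settled z F" and S: "S \<subseteq> mismatch A b z"
  shows "F \<inter> S = {}" "i \<in> F \<Longrightarrow> flip S z $ i = z $ i" "settled (flip S z) F"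
proof -
  show disj: "F \<inter> S = {}" using F z S unfolding settled_def by blast
  have Fn: "F \<subseteq> {..<n}" and zc: "dim_vec z = n" using F z by (auto simp: settled_def sign_vecs_def)
  have eq: "flip S z $ i = z $ i" if "i \<in> F" for i
    using that disj Fn zc by (subst flip_index) auto
  then show "i \<in> F \<Longrightarrow> flip S z $ i = z $ i" .
  show "settled (flip S z) F" using F eq by (simp add: settled_def)
qed

lemma max_settled_flip_mono:
  assumes z: "z \<in> sign_vecs n" and S: "S \<subseteq> mismatch A b z"
  shows "max_settled z \<le> max_settled (flip S z)"
proof -
  obtain F where F: "settled z F" "card F = max_settled z" by (rule max_settled_witness)
  then show ?thesis using settled_card_le[OF settled_flip(3)[OF z F(1) S]] by simp
qed

text \<open>The index is the dominant one for a settled F of maximal size. If its sign were already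
  right, adding it to F would contradict maximality; flipping it makes the sign right and F can be
  enlarged.\<close>

lemma max_settled_flip_progress:
  assumes z: "z \<in> sign_vecs n" and "mismatch A b z \<noteq> {}"
  obtains j where "j \<in> mismatch A b z"
    "\<And>S. S \<subseteq> mismatch A b z \<Longrightarrow> j \<in> S \<Longrightarrow> Suc (max_settled z) \<le> max_settled (flip S z)"
proof -
  obtain F where F: "settled z F" "card F = max_settled z" by (rule max_settled_witness)
  have finF: "finite F" and Fn: "F \<subseteq> {..<n}"
    using F(1) by (auto simp: settled_def intro: finite_subset)
  obtain p where p: "p \<in> mismatch A b z" using assms by auto
  have pn: "p < n" "z $ p * iterate A b z $ p < 0" using p mismatch_iff[OF z] by auto
  have pF: "p \<notin> F" using F(1) z p by (auto simp: settled_def)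
  obtain j s where j: "j < n" "j \<notin> F"
    and sgn: "\<And>z'. z' \<in> sign_vecs n \<Longrightarrow> (\<And>i. i \<in> F \<Longrightarrow> i < n \<Longrightarrow> z' $ i = z $ i) \<Longrightarrow>
      sgn (iterate A b z' $ j) = s"
    and zero: "\<And>z' k. z' \<in> sign_vecs n \<Longrightarrow> (\<And>i. i \<in> F \<Longrightarrow> i < n \<Longrightarrow> z' $ i = z $ i) \<Longrightarrow>
      s = 0 \<Longrightarrow> k < n \<Longrightarrow> k \<notin> F \<Longrightarrow> iterate A b z' $ k = 0"
    using sign_dominance[OF z b pn(1) pF] by blast
  \<comment> \<open>Otherwise all iterates would vanish outside F, but the mismatch p lies
    there.\<close>
  have s: "s \<noteq> 0" using zero[OF z refl _ pn(1) pF] pn(2) by auto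
  have sz: "sgn (iterate A b z $ j) = s" by (rule sgn[OF z refl])
  \<comment> \<open>Used twice: with w = z to refute that j is no mismatch, and with w the flipped
    vector to gain an element.\<close>
  have extend: "settled w (insert j F)"
    if w: "settled w F" "\<And>i. i \<in> F \<Longrightarrow> w $ i = z $ i" "0 \<le> w $ j * s" for w
    unfolding settled_def
  proof (intro conjI ballI impI)
    show "insert j F \<subseteq> {..<n}" using Fn j by auto
    fix z' assume z': "z' \<in> sign_vecs n" "\<forall>i\<in>insert j F. z' $ i = w $ i"
    have "sgn (iterate A b z' $ j) = s" using z' w(2) by (intro sgn) auto
    then have "0 \<le> z' $ j * iterate A b z' $ j"
      using w(3) z'(2) s by (auto simp: sgn_if zero_le_mult_iff split: if_splits)
    then have "j \<notin> mismatch A b z'" using mismatch_iff[OF z'(1)] by auto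
    then show "mismatch A b z' \<inter> insert j F = {}" using w(1) z' by (auto simp: settled_def)
  qed
  have card_extend: "Suc (max_settled z) \<le> max_settled w" if "settled w (insert j F)" for w
    using settled_card_le[OF that] finF j F(2) by simp
  show ?thesis
  proof (rule that)
    show jm: "j \<in> mismatch A b z"
    proof (rule ccontr)
      assume "j \<notin> mismatch A b z"
      then have "0 \<le> z $ j * s" using mismatch_iff[OF z, of j] j(1) sz
        by (auto simp: sgn_if zero_le_mult_iff mult_less_0_iff not_less split: if_splits)
      from card_extend[OF extend[OF F(1) refl this]] show False by simp
    qed
    fix S assume S: "S \<subseteq> mismatch A b z" "j \<in> S"
    note fl = settled_flip[OF z F(1) S(1)]
    have "z $ j * iterate A b z $ j < 0" using jm mismatch_iff[OF z] by auto
    then have "z $ j * s < 0" using sz by (auto simp: sgn_if mult_less_0_iff split: if_splits)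
    moreover have "flip S z $ j = - z $ j"
      using S(2) j(1) z by (subst flip_index) (auto simp: sign_vecs_def)
    ultimately have "0 \<le> flip S z $ j * s" by simp
    from card_extend[OF extend[OF fl(3) fl(2) this]]
    show "Suc (max_settled z) \<le> max_settled (flip S z)" .
  qed
qed

text \<open>Drift argument: a pass lowers the potential on the right by at least 1 in expectation,
  since \<open>max_settled\<close> never decreases and grows with probability at least m/n.\<close>

lemma expected_iterations_random_flip:
  assumes "z \<in> sign_vecs n" and m: "0 < m" "m \<le> n"
  shows "expected_iterations (sign_flip (random_flip_rule m) A b z)
    \<le> ennreal (real n / real m * (n - real (max_settled z)))"
proof -
  let ?f = "\<lambda>z. real n / real m * (n - real (max_settled z))"
  let ?P = "\<lambda>z. expected_iterations (sign_flip (random_flip_rule m) A b z) \<le> ennreal (?f z)"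
  show "?P z"
  proof (rule sign_flip_induct[where P = ?P, OF random_flip_rule_nonempty[OF m(1)] assms(1)])
    fix z
    assume step: "z \<in> sign_vecs n"
      "\<And>S. mismatch A b z \<noteq> {} \<Longrightarrow> S \<in> set_pmf (random_flip_rule m (mismatch A b z)) \<Longrightarrow> ?P (flip S z)"
    show "?P z"
    proof (cases "mismatch A b z = {}")
      case True
      then show ?thesis by (simp add: sign_flip_done expected_iterations_def measure_spmf_return_spmf nn_integral_return)
    next
      case False
      define V where "V = mismatch A b z"
      define p where "p = random_flip_rule m V"
      have V: "finite V" "V \<noteq> {}" using False by (auto simp: V_def)
      obtain j where j: "j \<in> V"
        and progress: "\<And>S. S \<subseteq> V \<Longrightarrow> j \<in> S \<Longrightarrow> Suc (max_settled z) \<le> max_settled (flip S z)"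
        using max_settled_flip_progress[OF step(1) False] unfolding V_def by blast
      have set_p: "S \<subseteq> V" if "S \<in> set_pmf p" for S
        using random_flip_rule_nonempty[OF m(1)] V that unfolding p_def by blast
      have fin: "finite (set_pmf p)"
        by (rule finite_subset[of _ "Pow V"]) (use set_p V in auto)
      \<comment> \<open>Upper bound for the present pass plus the potential after it; the indicator
        accounts for the gain when j is selected.\<close>
      define h where "h S = ?f z + 1 - real n / real m * indicator {S. j \<in> S} S" for S
      have h: "1 + ?f (flip S z) \<le> h S" if "S \<in> set_pmf p" for S
      proof -
        have "real (max_settled z) + indicator {S. j \<in> S} S \<le> real (max_settled (flip S z))"
          using progress[OF set_p[OF that]] max_settled_flip_mono[OF step(1), of S] set_p[OF that]
          by (auto simp: indicator_def V_def)
        then have "real n / real m * (real (max_settled z) + indicator {S. j \<in> S} S)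
            \<le> real n / real m * real (max_settled (flip S z))"
          by (intro mult_left_mono) auto
        then show ?thesis by (simp add: h_def right_diff_distrib distrib_left)
      qed
      have f_nonneg: "0 \<le> ?f w" for w using max_settled_le[of w] by simp
      have "expected_iterations (sign_flip (random_flip_rule m) A b z)
          \<le> (\<integral>\<^sup>+ S. 1 + expected_iterations (sign_flip (random_flip_rule m) A b (flip S z)) \<partial>p)"
        using expected_iterations_continue[OF False] unfolding p_def V_def .
      also have "\<dots> \<le> (\<integral>\<^sup>+ S. ennreal (h S) \<partial>p)"
      proof (rule nn_integral_mono_AE, unfold AE_measure_pmf_iff, rule ballI)
        fix S assume S: "S \<in> set_pmf p"
        have "expected_iterations (sign_flip (random_flip_rule m) A b (flip S z)) \<le> ennreal (?f (flip S z))"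
          using step(2)[OF False] S by (simp add: p_def V_def)
        then have "1 + expected_iterations (sign_flip (random_flip_rule m) A b (flip S z))
            \<le> 1 + ennreal (?f (flip S z))" by (rule add_left_mono)
        also have "\<dots> = ennreal (1 + ?f (flip S z))"
          using f_nonneg by (subst ennreal_plus) auto
        also have "\<dots> \<le> ennreal (h S)" using h[OF S] by (rule ennreal_leI)
        finally show "1 + expected_iterations (sign_flip (random_flip_rule m) A b (flip S z)) \<le> ennreal (h S)" .
      qed
      also have "\<dots> = ennreal (\<integral>S. h S \<partial>p)"
      proof (rule nn_integral_eq_integral)
        show "integrable p h" using fin by (rule integrable_measure_pmf_finite)
        show "AE S in p. 0 \<le> h S"
          unfolding AE_measure_pmf_iff using h f_nonneg by (smt (verit))
      qed
      also have "(\<integral>S. h S \<partial>p) = ?f z + 1 - real n / real m * measure_pmf.prob p {S. j \<in> S}"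
        unfolding h_def
        by (subst Bochner_Integration.integral_diff) (auto intro: integrable_measure_pmf_finite[OF fin])
      also have "ennreal \<dots> \<le> ennreal (?f z)"
      proof (rule ennreal_leI)
        have N: "0 < card V" "card V \<le> n"
          using V card_mono[of "{..<n}" V] mismatch_iff[OF step(1)] by (auto simp: V_def card_gt_0_iff)
        \<comment> \<open>The left factor n/m was chosen for this: the product is n/card V if m
          \<le> card V, and n/m otherwise.\<close>
        have "1 \<le> real n / real m * (real (min m (card V)) / real (card V))"
          using m N by (auto simp: min_def field_simps)
        then show "?f z + 1 - real n / real m * measure_pmf.prob p {S. j \<in> S} \<le> ?f z"
          unfolding p_def prob_random_flip_rule[OF V(1) j m(1)] by simp
      qed
      finally show ?thesis .
    qed
  qed
qed

end

end

section \<open>Unique solution, sure termination and the bound in terms of n, m and L\<close>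

theorem theorem4p4:
  fixes rho_bar :: real
  assumes "rho_bar < 1/2"
  shows "\<exists>C::real. C > 0 \<and>
    (\<forall>(n::nat) (m::nat) (A::real mat) (b::real vec) (A'::int mat) (b'::int vec)
      (dA::int) (db::int) (L::int) (z::real vec).
        A \<in> carrier_mat n n \<and> elements_mat A \<subseteq> \<rat> \<and>
        invertible_mat A \<and> real_spectral_radius (abs_mat (inv_mat A)) \<le> rho_bar \<and>
        b \<in> carrier_vec n \<and> vec_set b \<subseteq> \<rat> \<and>
        A' \<in> carrier_mat n n \<and> b' \<in> carrier_vec n \<and> dA > 0 \<and> db > 0 \<and>
        A = (1 / real_of_int dA) \<cdot>\<^sub>m map_mat real_of_int A' \<and>
        b = (1 / real_of_int db) \<cdot>\<^sub>v map_vec real_of_int b' \<and>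
        L = Max {db, dA, max_norm_vec b', max_norm_mat A'} \<and>
        m \<in> {1..n} \<and> z \<in> sign_vecs n
      \<longrightarrow>
        (\<exists>!x. ave_solution A b x) \<and>
        (\<nexists>zs. zs 0 = z \<and>
          (\<forall>k. sign_flip_step (random_flip_rule m) A b (zs k) (zs (Suc k)))) \<and>
        lossless_spmf (sign_flip (random_flip_rule m) A b z) \<and>
        (\<forall>(x, k) \<in> set_spmf (sign_flip (random_flip_rule m) A b z). ave_solution A b x) \<and>
        expected_iterations (sign_flip (random_flip_rule m) A b z)
          \<le> ennreal (C * (real n ^ 3 * ln (real n * real_of_int L) / real m)))"
proof (intro exI[of _ "1 / ln 2"] conjI allI impI)
  \<comment> \<open>The constant turns ln 2 \<le> ln (nL) into a factor of at least 1.\<close>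
  show "0 < 1 / ln (2::real)" by simp
  \<comment> \<open>The midpoint leaves room above \<open>rho_bar\<close>, as the weights require a
    strict inequality; the maximum with 0 keeps \<theta> nonnegative.\<close>
  define \<theta> where "\<theta> = (max rho_bar 0 + 1/2) / 2"
  have theta: "0 \<le> \<theta>" "\<theta> < 1/2" "rho_bar < \<theta>" using assms by (auto simp: \<theta>_def)
  fix n m :: nat and A :: "real mat" and b :: "real vec" and A' :: "int mat" and b' :: "int vec"
    and dA db L :: int and z :: "real vec"
  assume "A \<in> carrier_mat n n \<and> elements_mat A \<subseteq> \<rat> \<and>
        invertible_mat A \<and> real_spectral_radius (abs_mat (inv_mat A)) \<le> rho_bar \<and>
        b \<in> carrier_vec n \<and> vec_set b \<subseteq> \<rat> \<and>
        A' \<in> carrier_mat n n \<and> b' \<in> carrier_vec n \<and> dA > 0 \<and> db > 0 \<and>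
        A = (1 / real_of_int dA) \<cdot>\<^sub>m map_mat real_of_int A' \<and>
        b = (1 / real_of_int db) \<cdot>\<^sub>v map_vec real_of_int b' \<and>
        L = Max {db, dA, max_norm_vec b', max_norm_mat A'} \<and>
        m \<in> {1..n} \<and> z \<in> sign_vecs n"
  then have A: "A \<in> carrier_mat n n" and inv: "invertible_mat A"
    and radius: "real_spectral_radius (abs_mat (inv_mat A)) < \<theta>"
    and b: "b \<in> carrier_vec n" and A': "A' \<in> carrier_mat n n" and dA: "dA > 0"
    and A_eq: "A = (1 / real_of_int dA) \<cdot>\<^sub>m map_mat real_of_int A'"
    and L: "L = Max {db, dA, max_norm_vec b', max_norm_mat A'}"
    and m: "0 < m" "m \<le> n" and z: "z \<in> sign_vecs n"
    using theta by auto
  have n: "0 < n" using m by simp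
  have det: "det A \<noteq> 0" by (rule invertible_mat_det[OF A inv])
  have inv_carrier: "inv_mat A \<in> carrier_mat n n" using inv_mat_of_det[OF A det] by simp
  obtain v where v: "\<And>i. i < n \<Longrightarrow> 0 < v i"
    "\<And>i. i < n \<Longrightarrow> (\<Sum>j<n. abs_mat (inv_mat A) $$ (i, j) * v j) \<le> \<theta> * v i"
  proof (rule weighted_row_bound[OF _ n _ radius])
    show "abs_mat (inv_mat A) \<in> carrier_mat n n" using inv_carrier by (simp add: abs_mat_def)
    show "0 \<le> abs_mat (inv_mat A) $$ (i, j)" if "i < n" "j < n" for i j
      using that inv_carrier by (simp add: abs_mat_def)
  qed auto
  interpret weighted_contraction n A v \<theta>
  proof
    show "(\<Sum>j<n. \<bar>inv_mat A $$ (i, j)\<bar> * v j) \<le> \<theta> * v i" if "i < n" for i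
    proof -
      have "(\<Sum>j<n. \<bar>inv_mat A $$ (i, j)\<bar> * v j) = (\<Sum>j<n. abs_mat (inv_mat A) $$ (i, j) * v j)"
        using that inv_carrier by (intro sum.cong) (auto simp: abs_mat_def)
      then show ?thesis using v(2)[OF that] by simp
    qed
  qed (use A det v theta in auto)
  note nonempty = random_flip_rule_nonempty[OF m(1)]
  note correct = sign_flip_correct[OF b nonempty z]
  show lossless: "lossless_spmf (sign_flip (random_flip_rule m) A b z)"
    and solution: "\<forall>(x, k) \<in> set_spmf (sign_flip (random_flip_rule m) A b z). ave_solution A b x"
    using correct by auto
  show "\<nexists>zs. zs 0 = z \<and> (\<forall>k. sign_flip_step (random_flip_rule m) A b (zs k) (zs (Suc k)))"
    using no_infinite_run[OF b nonempty] z by blast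
  \<comment> \<open>Existence comes from the algorithm itself: a lossless run has an outcome, and
    every outcome is a solution.\<close>
  have "set_spmf (sign_flip (random_flip_rule m) A b z) \<noteq> {}"
    using lossless measure_spmf_zero_iff[of "sign_flip (random_flip_rule m) A b z" UNIV]
    by (auto simp: lossless_spmf_def space_measure_spmf)
  then have "\<exists>x. ave_solution A b x" using solution by fastforce
  then show "\<exists>!x. ave_solution A b x" using ave_solution_unique[OF b] by blast
  have L_ge: "dA \<le> L" "max_norm_mat A' \<le> L" unfolding L by auto
  \<comment> \<open>For n \<ge> 2 it suffices that L \<ge> dA \<ge> 1. For n = 1 the row bound gives
    |1/A| \<le> \<theta> < 1/2, so the integer numerator of A has absolute value at least 2.\<close>
  have nL: "2 \<le> real n * real_of_int L"
  proof (cases "n = 1")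
    case True
    have "\<bar>inv_mat A $$ (0, 0)\<bar> \<le> \<theta>"
      using row_bound[of 0] weight_pos[of 0] True by (simp add: lessThan_Suc)
    moreover have "\<bar>A $$ (0, 0)\<bar> * \<bar>inv_mat A $$ (0, 0)\<bar> = 1"
    proof -
      have "(A * inv_mat A) $$ (0, 0) = 1" using inv(2) True by simp
      then have "A $$ (0, 0) * inv_mat A $$ (0, 0) = 1"
        using A inv_carrier True by (simp add: scalar_prod_def)
      then show ?thesis by (simp add: abs_mult[symmetric])
    qed
    moreover have "\<bar>A $$ (0, 0)\<bar> \<le> \<bar>real_of_int (A' $$ (0, 0))\<bar>"
      using A' True dA unfolding A_eq by (simp add: divide_le_eq mult_le_cancel_left1)
    ultimately have "1 \<le> \<bar>real_of_int (A' $$ (0, 0))\<bar> * \<theta>"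
      by (metis abs_ge_zero mult_mono)
    also have "\<dots> \<le> \<bar>real_of_int (A' $$ (0, 0))\<bar> * (1/2)"
      using theta by (intro mult_left_mono) auto
    finally have "2 \<le> \<bar>A' $$ (0, 0)\<bar>" by linarith
    moreover have "\<bar>A' $$ (0, 0)\<bar> \<le> max_norm_mat A'"
    proof -
      have "finite (elements_mat A')" by (simp add: elements_mat_def)
      then show ?thesis using A' True unfolding max_norm_mat_def
        by (intro Max_ge) (auto simp: elements_mat_def)
    qed
    ultimately show ?thesis using L_ge True by simp
  next
    case False
    then have "2 * 1 \<le> real n * real_of_int L"
      using n L_ge dA by (intro mult_mono) auto
    then show ?thesis by simp
  qed
  have "expected_iterations (sign_flip (random_flip_rule m) A b z)
      \<le> ennreal (real n / real m * (n - real (max_settled b z)))"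
    by (rule expected_iterations_random_flip[OF b z m])
  also have "\<dots> \<le> ennreal (1 / ln 2 * (real n ^ 3 * ln (real n * real_of_int L) / real m))"
  proof (rule ennreal_leI)
    have "ln 2 \<le> ln (real n * real_of_int L)" using nL by simp
    \<comment> \<open>This factor raises n^2/m to the stated order n^3 ln(nL)/m.\<close>
    then have "1 * 1 \<le> real n * (ln (real n * real_of_int L) / ln 2)"
      using n by (intro mult_mono) auto
    then have "real n ^ 2 / m * 1 \<le> real n ^ 2 / m * (real n * (ln (real n * real_of_int L) / ln 2))"
      by (intro mult_left_mono) auto
    moreover have "real n / real m * (n - real (max_settled b z)) \<le> real n / real m * n"
      by (intro mult_left_mono) auto
    ultimately show "real n / real m * (n - real (max_settled b z))
        \<le> 1 / ln 2 * (real n ^ 3 * ln (real n * real_of_int L) / real m)"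
      by (simp add: power2_eq_square power3_eq_cube mult_ac)
  qed
  finally show "expected_iterations (sign_flip (random_flip_rule m) A b z)
      \<le> ennreal (1 / ln 2 * (real n ^ 3 * ln (real n * real_of_int L) / real m))" .
qed

end
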